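(* There exist instances of the connected $k$-center problem (with $k$ arbitrarily large) such that the ratio between the optimal radius of a connected $k$-center solution with disjoint clusters and the optimal radius of a connected $k$-center solution with non-disjoint clusters is $\Omega(\log\log k)$.
   Context: An instance consists of a finite point set $V$, a metric $d$ on $V$, an integer $k\ge1$, and an unweighted undirected connectivity graph $G=(V,E)$. A solution consists of $k$ clusters $C_1,\dots,C_k\subseteq V$ with $\bigcup_i C_i=V$, each inducing a connected subgraph of $G$, together with centers $c_i\in C_i$; its radius is $\max_i\max_{x\in C_i}d(x,c_i)$. In the version with disjoint clusters the $C_i$ must be pairwise disjoint; in the version with non-disjoint clusters they may overlap. *)

theory Defs
  imports
    "HOL-Analysis.Abstract_Metric_Spaces"
    "HOL-Library.Disjoint_Sets"
    "HOL-Library.Landau_Symbols"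
    "Graph_Theory.Graph_Theory"
begin

text \<open>
  An undirected graph is a symmetric digraph, as is usual in the session Graph_Theory;
  \<open>pair_graph\<close> says that it is finite, symmetric and without loops.
\<close>

locale connected_k_center =
  fixes V :: "'a set" and d :: "'a \<Rightarrow> 'a \<Rightarrow> real" and G :: "'a pair_pre_digraph" and k :: nat
  assumes finite_points: "finite V"
    and metric: "Metric_space V d"
    and graph: "pair_graph G"
    and verts_eq: "pverts G = V"
    and k_ge_1: "1 \<le> k"

text \<open>
  Clusters and centers are families of which only the indices below \<open>k\<close> matter.
  The qualified name selects graph connectivity rather than the topological notion.
\<close>

definition nondisjoint_solutions ::
    "'a set \<Rightarrow> 'a pair_pre_digraph \<Rightarrow> nat \<Rightarrow> ((nat \<Rightarrow> 'a set) \<times> (nat \<Rightarrow> 'a)) set" where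
  "nondisjoint_solutions V G k =
    {(C, c). (\<Union>i<k. C i) = V \<and>
      (\<forall>i<k. C i \<subseteq> V \<and> Digraph_Component.connected (with_proj G \<restriction> C i) \<and> c i \<in> C i)}"

definition disjoint_solutions ::
    "'a set \<Rightarrow> 'a pair_pre_digraph \<Rightarrow> nat \<Rightarrow> ((nat \<Rightarrow> 'a set) \<times> (nat \<Rightarrow> 'a)) set" where
  "disjoint_solutions V G k =
    {(C, c) \<in> nondisjoint_solutions V G k. disjoint_family_on C {..<k}}"

definition radius :: "('a \<Rightarrow> 'a \<Rightarrow> real) \<Rightarrow> nat \<Rightarrow> (nat \<Rightarrow> 'a set) \<Rightarrow> (nat \<Rightarrow> 'a) \<Rightarrow> real" where
  "radius d k C c = (MAX i\<in>{..<k}. MAX x\<in>C i. d x (c i))"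

text \<open>
  For finitely many points only finitely many radii occur, so the infimum is a minimum
  as soon as \<open>S\<close> is nonempty; for empty \<open>S\<close> the value is meaningless.
\<close>

definition opt_radius ::
    "('a \<Rightarrow> 'a \<Rightarrow> real) \<Rightarrow> nat \<Rightarrow> ((nat \<Rightarrow> 'a set) \<times> (nat \<Rightarrow> 'a)) set \<Rightarrow> real" where
  "opt_radius d k S = (INF (C, c)\<in>S. radius d k C c)"

end

theory Submission
  imports Defs "HOL-Library.Nat_Bijection"
begin

text \<open>
  Take the grid with coordinates \<open>0, \<dots>, r\<close>, where coordinate \<open>j\<close> has \<open>q j\<close> values and \<open>q t\<close>
  exceeds the product of all later \<open>q j\<close>. The points are the axis-parallel lines of the grid;
  lines of directions \<open>t\<close> and \<open>t + 1\<close> through a common grid point are adjacent, and the metric is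
  the Hamming distance. There are as many clusters as lines of direction \<open>0\<close>. With overlaps, the
  cluster of such a line consists of all lines that cross it, and has radius at most \<open>3\<close>.

  For disjoint clusters choose a grid point \<open>a\<close> coordinate by coordinate: \<open>a 0\<close> differs from
  coordinate \<open>0\<close> of all centers, and \<open>a t\<close> differs from coordinate \<open>t\<close> of the centers of all
  clusters that contain one of the few lines of direction \<open>t\<close> through a grid point starting with
  \<open>a 0, \<dots>, a (t - 1)\<close>. A cluster that contains the line of direction \<open>r\<close> through \<open>a\<close> must reach
  its center through such a line for every \<open>0 < t < r\<close>, so its center differs from \<open>a\<close> in all of the
  coordinates \<open>0, \<dots>, r - 1\<close>. The \<open>q j\<close> grow doubly exponentially, hence \<open>ln (ln k) \<le> r\<close>.
\<close>

section \<open>Connectivity of induced subgraphs in terms of walks\<close>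

lemma connected_induced_iff:
  assumes "sym (parcs G)"
  shows "Digraph_Component.connected (with_proj G \<restriction> C) \<longleftrightarrow>
    C \<noteq> {} \<and> (\<forall>u\<in>C. \<forall>v\<in>C. (u, v) \<in> rtrancl_on C (parcs G))"
proof -
  have ends: "(arcs_ends (with_proj G \<restriction> C))\<^sup>s = {(u, v) \<in> parcs G. u \<in> C \<and> v \<in> C}"
    using assms by (auto simp: induce_subgraph_def symcl_def arcs_ends_conv sym_def image_iff)
  \<comment> \<open>Walks in \<open>rtrancl_on C\<close> already stay inside \<open>C\<close>, so
    cutting the relation down to \<open>C\<close> changes nothing.\<close>
  have "rtrancl_on C {(u, v) \<in> parcs G. u \<in> C \<and> v \<in> C} = rtrancl_on C (parcs G)" (is "?L = ?R")
  proof (intro equalityI subrelI)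
    fix u v assume "(u, v) \<in> ?L"
    then show "(u, v) \<in> ?R"
      by (rule rtrancl_on_mono[rotated 2]) auto
  next
    fix u v assume "(u, v) \<in> ?R"
    then show "(u, v) \<in> ?L"
      by (induct rule: rtrancl_on_induct) (auto intro: rtrancl_on_into_rtrancl_on)
  qed
  then show ?thesis
    using connected_conv[of "with_proj G \<restriction> C"] ends by simp
qed

text \<open>Follow the walk until membership in \<open>A\<close> first fails. Later this forces a
  cluster to leave a region on the way to its center.\<close>

lemma rtrancl_on_crossing:
  assumes "(u, v) \<in> rtrancl_on F R" "u \<in> A" "v \<notin> A"
  obtains x y where "(x, y) \<in> R" "x \<in> F" "y \<in> F" "x \<in> A" "y \<notin> A"
proof -
  have "v \<in> A \<or> (\<exists>x y. (x, y) \<in> R \<and> x \<in> F \<and> y \<in> F \<and> x \<in> A \<and> y \<notin> A)"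
    using assms(1) by (induct rule: rtrancl_on_induct) (use assms(2) in auto)
  then show ?thesis using assms(3) that by blast
qed

section \<open>The instance: grid lines, Hamming distance and links\<close>

locale line_instance =
  fixes r :: nat and q :: "nat \<Rightarrow> nat"
  assumes r_pos: "1 \<le> r"
    and q_last: "0 < q r"
    and q_grows: "\<And>t. t < r \<Longrightarrow> (\<Prod>j=Suc t..r. q j) < q t"
begin

text \<open>The line of direction \<open>t\<close> through \<open>b\<close>: coordinate \<open>t\<close> is forgotten by setting it to \<open>0\<close>.\<close>
definition line :: "nat \<Rightarrow> (nat \<Rightarrow> nat) \<Rightarrow> nat" where
  "line t b = list_encode (t # map (b(t := 0)) [0..<Suc r])"

definition level :: "nat \<Rightarrow> nat" where
  "level v = list_decode v ! 0"

definition coord :: "nat \<Rightarrow> nat \<Rightarrow> nat" where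
  "coord v j = list_decode v ! Suc j"

text \<open>Entry 0 of a code is the direction, so \<open>r + 2\<close> entries are compared. The
  direction has to count: lines of different directions through the zero point agree in all
  coordinates.\<close>

definition hamming :: "nat \<Rightarrow> nat \<Rightarrow> real" where
  "hamming v w = card {i. i < r + 2 \<and> list_decode v ! i \<noteq> list_decode w ! i}"

definition box :: "(nat \<Rightarrow> nat) set" where
  "box = {b. \<forall>j\<le>r. b j < q j}"

definition points :: "nat set" where
  "points = {line t b |t b. t \<le> r \<and> b \<in> box}"

definition links :: "nat rel" where
  "links = {(line t b, line (Suc t) b) |t b. t < r \<and> b \<in> box}"

definition line_graph :: "nat pair_pre_digraph" where
  "line_graph = \<lparr>pverts = points, parcs = links \<union> links\<inverse>\<rparr>"

definition num :: nat where
  "num = (\<Prod>j=1..r. q j)"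

definition codes :: "(nat \<Rightarrow> nat) set" where
  "codes = (\<Pi>\<^sub>E j\<in>{1..r}. {..<q j})"

lemma nth_map_upt_Suc: "j \<le> r \<Longrightarrow> map f [0..<Suc r] ! j = f j"
  by (metis add_0 diff_zero less_Suc_eq_le nth_map_upt)

lemma level_line [simp]: "level (line t b) = t"
  by (simp add: level_def line_def)

lemma coord_line: "j \<le> r \<Longrightarrow> coord (line t b) j = (if j = t then 0 else b j)"
  unfolding coord_def line_def by (simp only: list_encode_inverse nth_Cons_Suc nth_map_upt_Suc) simp

lemma line_eq_iff: "line t b = line t' b' \<longleftrightarrow> t = t' \<and> (\<forall>j\<le>r. j \<noteq> t \<longrightarrow> b j = b' j)"
proof
  assume eq: "line t b = line t' b'"
  then have "t = t'" by (metis level_line)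
  moreover have "b j = b' j" if "j \<le> r" "j \<noteq> t" for j
    using coord_line[OF that(1), of t b] coord_line[OF that(1), of t' b'] eq that \<open>t = t'\<close> by simp
  ultimately show "t = t' \<and> (\<forall>j\<le>r. j \<noteq> t \<longrightarrow> b j = b' j)" by simp
next
  assume "t = t' \<and> (\<forall>j\<le>r. j \<noteq> t \<longrightarrow> b j = b' j)"
  then show "line t b = line t' b'"
    unfolding line_def list_encode_eq by (intro conjI arg_cong2[of _ _ _ _ Cons] map_cong) auto
qed

lemma line_points: "t \<le> r \<Longrightarrow> b \<in> box \<Longrightarrow> line t b \<in> points"
  unfolding points_def by blast

lemma line_links: "t < r \<Longrightarrow> b \<in> box \<Longrightarrow> (line t b, line (Suc t) b) \<in> links"
  unfolding links_def by blast

lemma q_pos: "j \<le> r \<Longrightarrow> 0 < q j"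
  using q_last q_grows[of j] by (cases "j = r") auto

lemma num_pos: "1 \<le> num"
  using q_pos unfolding num_def by (simp add: Suc_le_eq prod_pos)

lemma num_less: "num < q 0"
  using q_grows[of 0] r_pos by (simp add: num_def)

lemma finite_codes: "finite codes"
  by (auto simp: codes_def intro: finite_PiE)

lemma card_codes: "card codes = num"
  by (simp add: codes_def num_def card_PiE)

lemma finite_points: "finite points"
proof -
  \<comment> \<open>\<open>box\<close> is infinite, but cutting its functions off beyond
    \<open>r\<close> does not change their lines.\<close>
  have "points \<subseteq> (\<lambda>(t, b). line t b) ` ({..r} \<times> (\<Pi>\<^sub>E j\<in>{..r}. {..<q j}))"
  proof
    fix x assume "x \<in> points"
    then obtain t b where x: "x = line t b" "t \<le> r" "b \<in> box" by (auto simp: points_def)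
    then have "x = line t (restrict b {..r})" by (simp add: line_eq_iff)
    moreover have "restrict b {..r} \<in> (\<Pi>\<^sub>E j\<in>{..r}. {..<q j})" using x(3) by (auto simp: box_def)
    ultimately show "x \<in> (\<lambda>(t, b). line t b) ` ({..r} \<times> (\<Pi>\<^sub>E j\<in>{..r}. {..<q j}))"
      using x(2) by (intro image_eqI[of _ _ "(t, restrict b {..r})"]) auto
  qed
  then show ?thesis by (rule finite_subset) (auto intro: finite_PiE)
qed

text \<open>Codes of points have exactly \<open>r + 2\<close> entries, so the compared entries
  determine the code.\<close>

lemma hamming_zero:
  assumes "x \<in> points" "y \<in> points"
  shows "hamming x y = 0 \<longleftrightarrow> x = y"
proof
  assume "hamming x y = 0"
  then have eq: "list_decode x ! i = list_decode y ! i" if "i < r + 2" for i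
    using that by (auto simp: hamming_def)
  have "length (list_decode x) = r + 2" "length (list_decode y) = r + 2"
    using assms by (auto simp: points_def line_def)
  then have "list_decode x = list_decode y" using eq by (intro nth_equalityI) auto
  then show "x = y" by (simp add: list_decode_eq)
qed (simp add: hamming_def)

lemma Metric_space_hamming: "Metric_space points hamming"
proof
  fix x y z
  show "0 \<le> hamming x y" by (simp add: hamming_def)
  show "hamming x y = hamming y x" unfolding hamming_def by metis
  \<comment> \<open>Where \<open>x\<close> and \<open>z\<close> differ, \<open>y\<close> differs
    from one of them.\<close>
  have "card {i. i < r + 2 \<and> list_decode x ! i \<noteq> list_decode z ! i} \<le>
    card ({i. i < r + 2 \<and> list_decode x ! i \<noteq> list_decode y ! i} \<union>
          {i. i < r + 2 \<and> list_decode y ! i \<noteq> list_decode z ! i})"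
    by (rule card_mono) auto
  also have "\<dots> \<le> card {i. i < r + 2 \<and> list_decode x ! i \<noteq> list_decode y ! i} +
          card {i. i < r + 2 \<and> list_decode y ! i \<noteq> list_decode z ! i}"
    by (rule card_Un_le)
  finally show "hamming x z \<le> hamming x y + hamming y z" by (simp add: hamming_def)
qed (rule hamming_zero)

lemma links_points: "(u, v) \<in> links \<Longrightarrow> u \<in> points \<and> v \<in> points"
  by (fastforce simp: links_def points_def)

lemma sym_links: "sym (links \<union> links\<inverse>)"
  by (simp add: sym_Un_converse)

lemma pair_graph_line_graph: "pair_graph line_graph"
proof
  have sub: "parcs line_graph \<subseteq> points \<times> points"
    using links_points by (auto simp: line_graph_def)
  show "fst e \<in> pverts line_graph" "snd e \<in> pverts line_graph" if "e \<in> parcs line_graph" for e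
    using sub that by (auto simp: line_graph_def)
  show "finite (pverts line_graph)" by (simp add: line_graph_def finite_points)
  show "finite (parcs line_graph)"
    using sub finite_points by (meson finite_SigmaI finite_subset)
  show "fst e \<noteq> snd e" if "e \<in> parcs line_graph" for e
    using that by (auto simp: line_graph_def links_def line_eq_iff)
  show "symmetric (with_proj line_graph)"
    by (simp add: symmetric_def line_graph_def sym_Un_converse)
qed

lemma connected_k_center_lines: "connected_k_center points hamming line_graph num"
  using finite_points Metric_space_hamming pair_graph_line_graph num_pos
  by (simp add: connected_k_center_def line_graph_def)

lemma connected_lines_iff:
  "Digraph_Component.connected (with_proj line_graph \<restriction> C) \<longleftrightarrow>
    C \<noteq> {} \<and> (\<forall>u\<in>C. \<forall>v\<in>C. (u, v) \<in> rtrancl_on C (links \<union> links\<inverse>))"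
  using connected_induced_iff[of line_graph C] sym_links by (simp add: line_graph_def)

text \<open>Links are used in both directions, so two walks to a common hub \<open>z\<close> can be
  joined.\<close>

lemma connected_linesI:
  assumes "z \<in> C" "\<And>u. u \<in> C \<Longrightarrow> (u, z) \<in> rtrancl_on C (links \<union> links\<inverse>)"
  shows "Digraph_Component.connected (with_proj line_graph \<restriction> C)"
  unfolding connected_lines_iff
proof (intro conjI ballI)
  fix u v assume "u \<in> C" "v \<in> C"
  then show "(u, v) \<in> rtrancl_on C (links \<union> links\<inverse>)"
    by (intro rtrancl_on_trans[OF assms(2) symD[OF rtrancl_on_sym[OF sym_links] assms(2)]])
next
  show "C \<noteq> {}" using assms(1) by auto
qed

text \<open>The lines through one grid point, ordered by direction, form a path in the
  graph.\<close>

lemma rtrancl_on_line: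
  assumes "b \<in> box" "s \<le> t" "t \<le> r" "\<And>j. s \<le> j \<Longrightarrow> j \<le> t \<Longrightarrow> line j b \<in> S"
  shows "(line t b, line s b) \<in> rtrancl_on S (links \<union> links\<inverse>)"
  using assms(2,3,4)
proof (induct t rule: dec_induct)
  case (step t)
  then have "(line (Suc t) b, line t b) \<in> links \<union> links\<inverse>"
    using assms(1) by (auto intro: line_links)
  moreover have "(line t b, line s b) \<in> rtrancl_on S (links \<union> links\<inverse>)"
    using step by simp
  moreover have "line (Suc t) b \<in> S" using step by simp
  ultimately show ?case by (rule converse_rtrancl_on_into_rtrancl_on)
qed simp

section \<open>Pencils, the overlapping clusters\<close>

lemma codes_box: "s \<in> codes \<Longrightarrow> s(0 := 0) \<in> box"
  using q_pos by (auto simp: codes_def box_def PiE_iff)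

lemma line_0_upd: "line 0 (s(0 := x)) = line 0 s"
  by (simp add: line_eq_iff)

lemma line_0_points: "s \<in> codes \<Longrightarrow> line 0 s \<in> points"
  using line_points[of 0 "s(0 := 0)"] codes_box by (simp add: line_0_upd)

lemma inj_line_0: "inj_on (line 0) codes"
proof (rule inj_onI)
  fix s s' assume "s \<in> codes" "s' \<in> codes" "line 0 s = line 0 s'"
  then show "s = s'"
    unfolding codes_def by (intro PiE_ext) (auto simp: line_eq_iff)
qed

text \<open>The cluster of the direction 0 line with code \<open>s\<close>: \<open>b 0\<close> may
  vary, so \<open>b\<close> runs over the grid points of that line.\<close>

definition pencil :: "(nat \<Rightarrow> nat) \<Rightarrow> nat set" where
  "pencil s = {line t b |t b. t \<le> r \<and> b \<in> box \<and> (\<forall>j\<in>{1..r}. b j = s j)}"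

lemma line_pencil:
  "t \<le> r \<Longrightarrow> b \<in> box \<Longrightarrow> \<forall>j\<in>{1..r}. b j = s j \<Longrightarrow> line t b \<in> pencil s"
  unfolding pencil_def by blast

lemma line_0_pencil: "s \<in> codes \<Longrightarrow> line 0 s \<in> pencil s"
  using line_pencil[of 0 "s(0 := 0)" s] codes_box by (simp add: line_0_upd)

lemma connected_pencil:
  assumes "s \<in> codes"
  shows "Digraph_Component.connected (with_proj line_graph \<restriction> pencil s)"
proof (rule connected_linesI)
  show "line 0 s \<in> pencil s" using assms by (rule line_0_pencil)
next
  fix u assume "u \<in> pencil s"
  then obtain t b where u: "u = line t b" "t \<le> r" "b \<in> box" "\<forall>j\<in>{1..r}. b j = s j"
    by (auto simp: pencil_def)
  then have "(line t b, line 0 b) \<in> rtrancl_on (pencil s) (links \<union> links\<inverse>)"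
    by (intro rtrancl_on_line line_pencil) auto
  moreover have "line 0 b = line 0 s" using u(4) by (auto simp: line_eq_iff)
  ultimately show "(u, line 0 s) \<in> rtrancl_on (pencil s) (links \<union> links\<inverse>)" using u(1) by simp
qed

lemma hamming_pencil_le:
  assumes "x \<in> pencil s"
  shows "hamming x (line 0 s) \<le> 3"
proof -
  obtain t b where x: "x = line t b" "t \<le> r" "b \<in> box" "\<forall>j\<in>{1..r}. b j = s j"
    using assms by (auto simp: pencil_def)
  have "{i. i < r + 2 \<and> list_decode x ! i \<noteq> list_decode (line 0 s) ! i} \<subseteq> {0, 1, Suc t}"
  proof
    fix i assume i: "i \<in> {i. i < r + 2 \<and> list_decode x ! i \<noteq> list_decode (line 0 s) ! i}"
    show "i \<in> {0, 1, Suc t}"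
    proof (rule ccontr)
      assume "i \<notin> {0, 1, Suc t}"
      then obtain j where j: "i = Suc j" "1 \<le> j" "j \<noteq> t" by (cases i) auto
      then have "coord x j \<noteq> coord (line 0 s) j" "j \<le> r" using i by (auto simp: coord_def)
      then show False using j x by (simp add: coord_line)
    qed
  qed
  then have "card {i. i < r + 2 \<and> list_decode x ! i \<noteq> list_decode (line 0 s) ! i} \<le>
      card {0, 1, Suc t}"
    by (intro card_mono) auto
  also have "\<dots> \<le> 3" by (simp add: card_insert_if)
  finally show ?thesis by (simp add: hamming_def)
qed

lemma UN_pencil: "(\<Union>s\<in>codes. pencil s) = points"
proof
  show "(\<Union>s\<in>codes. pencil s) \<subseteq> points" by (auto simp: pencil_def points_def)
  show "points \<subseteq> (\<Union>s\<in>codes. pencil s)"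
  proof
    fix x assume "x \<in> points"
    then obtain t b where x: "x = line t b" "t \<le> r" "b \<in> box" by (auto simp: points_def)
    then have "restrict b {1..r} \<in> codes" "x \<in> pencil (restrict b {1..r})"
      by (auto simp: codes_def box_def pencil_def)
    then show "x \<in> (\<Union>s\<in>codes. pencil s)" by blast
  qed
qed

section \<open>Radii of solutions with overlaps\<close>

lemma solution_covers:
  assumes "(C, c) \<in> nondisjoint_solutions points line_graph num" "x \<in> points"
  obtains i where "i < num" "x \<in> C i"
proof -
  have "x \<in> (\<Union>i<num. C i)" using assms by (simp add: nondisjoint_solutions_def)
  then show ?thesis using that by blast
qed

lemma radius_ge:
  assumes sol: "(C, c) \<in> nondisjoint_solutions points line_graph num"
    and i: "i < num" and x: "x \<in> C i"
  shows "hamming x (c i) \<le> radius hamming num C c"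
proof -
  have fin: "finite (C i)"
    using sol i finite_points by (auto simp: nondisjoint_solutions_def intro: finite_subset)
  have "hamming x (c i) \<le> (MAX x\<in>C i. hamming x (c i))" using fin x by simp
  also have "\<dots> \<le> radius hamming num C c"
    unfolding radius_def using i by (intro Max_ge) auto
  finally show ?thesis .
qed

lemma radius_nonneg:
  assumes "(C, c) \<in> nondisjoint_solutions points line_graph num"
  shows "0 \<le> radius hamming num C c"
proof -
  have "c 0 \<in> C 0" using assms num_pos by (auto simp: nondisjoint_solutions_def)
  from radius_ge[OF assms _ this] show ?thesis
    using num_pos by (simp add: hamming_def)
qed

lemma nondisjoint_solution_radius_le:
  obtains C c where "(C, c) \<in> nondisjoint_solutions points line_graph num"
    "radius hamming num C c \<le> 3"
proof -
  obtain e where e: "bij_betw e {..<num} codes"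
    using ex_bij_betw_nat_finite[OF finite_codes] card_codes by (auto simp: atLeast0LessThan)
  then have ec: "e i \<in> codes" if "i < num" for i using that by (auto simp: bij_betw_def)
  define C where "C = (\<lambda>i. pencil (e i))"
  define c where "c = (\<lambda>i. line 0 (e i))"
  have "(\<Union>i<num. C i) = points"
    using e UN_pencil unfolding C_def bij_betw_def by (metis image_image)
  then have sol: "(C, c) \<in> nondisjoint_solutions points line_graph num"
    using ec by (auto simp: nondisjoint_solutions_def C_def c_def connected_pencil line_0_pencil)
  have "radius hamming num C c \<le> 3"
    unfolding radius_def
  proof (intro Max.boundedI)
    fix m assume "m \<in> (\<lambda>i. MAX x\<in>C i. hamming x (c i)) ` {..<num}"
    then obtain i where i: "i < num" and m: "m = (MAX x\<in>C i. hamming x (c i))" by auto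
    have "finite (C i)" "C i \<noteq> {}"
      using sol i finite_points by (auto simp: nondisjoint_solutions_def intro: finite_subset)
    then show "m \<le> 3" unfolding m
      by (intro Max.boundedI) (auto simp: C_def c_def hamming_pencil_le)
  next
    have "0 \<in> {..<num}" using num_pos by simp
    then show "(\<lambda>i. MAX x\<in>C i. hamming x (c i)) ` {..<num} \<noteq> {}" by blast
  qed simp
  with sol show ?thesis by (rule that)
qed

text \<open>There are only \<open>num\<close> centers, but more than \<open>num\<close> values for
  coordinate 0.\<close>

lemma ex_missed_copy:
  obtains m where "m < q 0" "\<And>i. i < num \<Longrightarrow> coord (c i) 0 \<noteq> m"
proof -
  have "card ((\<lambda>i. coord (c i) 0) ` {..<num}) \<le> num"
    using card_image_le[of "{..<num}" "\<lambda>i. coord (c i) 0"] by simp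
  then have "\<not> {..<q 0} \<subseteq> (\<lambda>i. coord (c i) 0) ` {..<num}"
    using num_less by (metis card_lessThan card_mono finite_imageI finite_lessThan leD le_trans)
  then show ?thesis using that by blast
qed

text \<open>A line whose coordinate 0 is shared by no center is not a center itself. The bound keeps
  the denominator of the ratio positive.\<close>

lemma nondisjoint_radius_ge_1:
  assumes "(C, c) \<in> nondisjoint_solutions points line_graph num"
  shows "1 \<le> radius hamming num C c"
proof -
  obtain m where m: "m < q 0" "\<And>i. i < num \<Longrightarrow> coord (c i) 0 \<noteq> m" by (rule ex_missed_copy[of c]) blast
  \<comment> \<open>Direction 1, since direction 0 would forget the value \<open>m\<close>.\<close>
  define x where "x = line 1 ((\<lambda>_. 0)(0 := m))"
  have "x \<in> points"
    using m(1) q_pos r_pos unfolding x_def by (intro line_points) (auto simp: box_def)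
  then obtain i where i: "i < num" "x \<in> C i"
    using solution_covers[OF assms] by blast
  have "c i \<in> points" using assms i(1) by (auto simp: nondisjoint_solutions_def)
  moreover have "x \<noteq> c i" using m(2)[OF i(1)] coord_line[of 0 1 "(\<lambda>_. 0)(0 := m)"] by (auto simp: x_def)
  ultimately have "hamming x (c i) \<noteq> 0" using hamming_zero \<open>x \<in> points\<close> by blast
  then have "1 \<le> hamming x (c i)"
    unfolding hamming_def of_nat_eq_0_iff by linarith
  then show ?thesis using radius_ge[OF assms i] by simp
qed

section \<open>Existence of a solution with disjoint clusters\<close>

lemma disjoint_solutions_nonempty: "disjoint_solutions points line_graph num \<noteq> {}"
proof -
  obtain e where e: "bij_betw e {..<num} codes"
    using ex_bij_betw_nat_finite[OF finite_codes] card_codes by (auto simp: atLeast0LessThan)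
  then have ec: "e i \<in> codes" if "i < num" for i using that by (auto simp: bij_betw_def)
  define c where "c = (\<lambda>i. line 0 (e i))"
  have inj: "inj_on c {..<num}"
    using e inj_line_0 comp_inj_on[of e "{..<num}" "line 0"] by (auto simp: bij_betw_def c_def comp_def)
  \<comment> \<open>All direction 0 lines except \<open>c 0\<close> become singleton clusters, and
    \<open>S\<close> is the remaining cluster. It has to be connected with \<open>c 0\<close> as its
    only line of direction 0.\<close>
  define S where "S = points - c ` {1..<num}"
  have c0: "c 0 \<in> S"
    using line_0_points ec num_pos inj unfolding S_def c_def inj_on_def by fastforce
  have lineS: "line t b \<in> S" if "1 \<le> t" "t \<le> r" "b \<in> box" for t b
    using that by (auto simp: S_def c_def line_eq_iff intro: line_points)
  have conn: "Digraph_Component.connected (with_proj line_graph \<restriction> S)"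
  proof (rule connected_linesI[OF c0])
    fix u assume u: "u \<in> S"
    let ?R = "rtrancl_on S (links \<union> links\<inverse>)"
    obtain t b where tb: "u = line t b" "t \<le> r" "b \<in> box" using u by (auto simp: S_def points_def)
    \<comment> \<open>For \<open>t > 0\<close>, descend along \<open>b\<close> to direction 1, climb
      to direction \<open>r\<close> while turning \<open>b\<close> into \<open>e 0\<close>, then
      descend to \<open>c 0\<close>. For \<open>t = 0\<close>, only \<open>c 0\<close> itself is
      left in \<open>S\<close>.\<close>
    show "(u, c 0) \<in> ?R"
    proof (cases "t = 0")
      case True
      define s where "s = restrict b {1..r}"
      have "s \<in> codes" using tb(3) by (auto simp: s_def codes_def box_def)
      then obtain i where i: "i < num" "s = e i" using e by (auto simp: bij_betw_def)
      have "line 0 b = line 0 s" by (simp add: line_eq_iff s_def)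
      then have "u = c i" using tb(1) True i(2) by (simp add: c_def)
      then have "u = c 0" using u i(1) by (cases i) (auto simp: S_def)
      then show ?thesis using c0 by simp
    next
      case False
      \<comment> \<open>Replace the coordinates of \<open>b\<close> by those of \<open>e 0\<close> one at a time: a line of
        direction \<open>j\<close> does not see the change of coordinate \<open>j\<close>.\<close>
      define mix where "mix = (\<lambda>j i. if 1 \<le> i \<and> i \<le> j then e 0 i else b i)"
      have mix: "mix j \<in> box" if "j \<le> r" for j
        using that tb(3) ec[of 0] num_pos by (auto simp: mix_def box_def codes_def PiE_iff)
      have "(line 1 b, line (Suc j) (mix j)) \<in> ?R" if "j < r" for j
        using that
      proof (induct j)
        case 0
        have "mix 0 = b" by (auto simp: mix_def)
        then show ?case using lineS[of 1 b] r_pos tb(3) by simp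
      next
        case (Suc j)
        have "line (Suc j) (mix j) = line (Suc j) (mix (Suc j))"
          by (auto simp: line_eq_iff mix_def le_Suc_eq)
        moreover have "(line (Suc j) (mix (Suc j)), line (Suc (Suc j)) (mix (Suc j))) \<in> links"
          using Suc.prems mix[of "Suc j"] unfolding links_def by auto
        moreover have "line (Suc (Suc j)) (mix (Suc j)) \<in> S"
          using Suc.prems mix[of "Suc j"] by (intro lineS) auto
        moreover have "(line 1 b, line (Suc j) (mix j)) \<in> ?R" using Suc by simp
        ultimately show ?case by (metis UnI1 rtrancl_on_into_rtrancl_on)
      qed
      from this[of "r - 1"] have "(line 1 b, line r (mix (r - 1))) \<in> ?R" using r_pos by simp
      \<comment> \<open>Direction \<open>r\<close> forgets coordinate \<open>r\<close>, the last one
        still to be replaced.\<close>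
      moreover have "line r (mix (r - 1)) = line r (mix r)"
        using r_pos by (auto simp: line_eq_iff mix_def)
      moreover have fin: "line 0 (mix r) = c 0" by (auto simp: c_def line_eq_iff mix_def)
      moreover have "(line r (mix r), line 0 (mix r)) \<in> ?R"
      proof (rule rtrancl_on_line)
        show "line j (mix r) \<in> S" if "j \<le> r" for j
          using that lineS[of j "mix r"] mix[of r] fin c0 by (cases "j = 0") auto
      qed (use mix in auto)
      moreover have "(line t b, line 1 b) \<in> ?R"
        using False tb by (intro rtrancl_on_line lineS) auto
      ultimately show ?thesis using tb(1) by (metis rtrancl_on_trans)
    qed
  qed
  define C where "C = (\<lambda>i. if i = 0 then S else {c i})"
  have cp: "c i \<in> points" if "i < num" for i using that ec line_0_points by (simp add: c_def)
  have "(\<Union>i<num. C i) = points"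
  proof
    show "(\<Union>i<num. C i) \<subseteq> points" using cp by (auto simp: C_def S_def split: if_splits)
    show "points \<subseteq> (\<Union>i<num. C i)"
    proof
      fix x assume "x \<in> points"
      then consider "x \<in> S" | i where "1 \<le> i" "i < num" "x = c i"
        by (fastforce simp: S_def)
      then show "x \<in> (\<Union>i<num. C i)"
      proof cases
        case 1 then show ?thesis using num_pos by (auto simp: C_def intro!: bexI[of _ 0])
      next
        case 2 then show ?thesis by (auto simp: C_def intro!: bexI[of _ i])
      qed
    qed
  qed
  moreover have "Digraph_Component.connected (with_proj line_graph \<restriction> C i)" for i
    using conn by (auto simp: C_def intro: connected_linesI)
  moreover have "C i \<subseteq> points" "c i \<in> C i" if "i < num" for i
    using that cp c0 by (auto simp: C_def S_def)
  moreover have "disjoint_family_on C {..<num}"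
    using inj by (auto simp: disjoint_family_on_def C_def S_def inj_on_def)
  ultimately have "(C, c) \<in> disjoint_solutions points line_graph num"
    by (auto simp: disjoint_solutions_def nondisjoint_solutions_def)
  then show ?thesis by blast
qed

section \<open>Lower bound for disjoint clusters\<close>

definition region :: "nat \<Rightarrow> (nat \<Rightarrow> nat) \<Rightarrow> nat set" where
  "region t a = {line s b |s b. t < s \<and> s \<le> r \<and> b \<in> box \<and> (\<forall>j\<le>t. b j = a j)}"

lemma line_region:
  "t < s \<Longrightarrow> s \<le> r \<Longrightarrow> b \<in> box \<Longrightarrow> \<forall>j\<le>t. b j = a j \<Longrightarrow> line s b \<in> region t a"
  unfolding region_def by blast

text \<open>Lines of direction above \<open>t\<close> forget none of the coordinates up to
  \<open>t\<close>, and linked lines share a grid point. So a link can leave the region only by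
  lowering the direction to \<open>t\<close>; that line forgets coordinate \<open>t\<close>, hence
  only \<open>j < t\<close> is recorded.\<close>

lemma region_exit:
  assumes "(u, w) \<in> links \<union> links\<inverse>" "u \<in> region t a" "w \<notin> region t a"
  obtains b where "w = line t b" "b \<in> box" "\<forall>j<t. b j = a j"
proof -
  obtain s' b' where u: "u = line s' b'" "t < s'" "s' \<le> r" "b' \<in> box" "\<forall>j\<le>t. b' j = a j"
    using assms(2) by (auto simp: region_def)
  have "\<exists>s b. s < r \<and> b \<in> box \<and> (u = line s b \<and> w = line (Suc s) b \<or> w = line s b \<and> u = line (Suc s) b)"
    using assms(1) by (auto simp: links_def)
  then obtain s b where s: "s < r" "b \<in> box"
    and uw: "u = line s b \<and> w = line (Suc s) b \<or> w = line s b \<and> u = line (Suc s) b" by blast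
  have pre: "\<forall>j\<le>t. b j = a j"
    using uw u by (auto simp: line_eq_iff)
  from uw show ?thesis
  proof
    assume *: "u = line s b \<and> w = line (Suc s) b"
    then have "s = s'" using u(1) by (simp add: line_eq_iff)
    then have "w \<in> region t a" using * s pre u(2) by (auto intro: line_region)
    then show ?thesis using assms(3) by simp
  next
    assume *: "w = line s b \<and> u = line (Suc s) b"
    then have "Suc s = s'" using u(1) by (simp add: line_eq_iff)
    moreover have "\<not> t < s"
      using * s pre assms(3) line_region[of t s b a] by auto
    ultimately have "s = t" using u(2) by simp
    then show ?thesis using that[of b] * s pre by auto
  qed
qed

text \<open>The lines of direction \<open>t\<close> in question number at most the product of the
  later \<open>q j\<close>, and by disjointness each lies in at most one cluster. So fewer than
  \<open>q t\<close> values have to be avoided.\<close>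

lemma coord_avoiding_centers:
  assumes disj: "disjoint_family_on C {..<num}" and t: "t < r"
  obtains v where "v < q t"
    "\<And>i b. i < num \<Longrightarrow> b \<in> box \<Longrightarrow> \<forall>j<t. b j = a j \<Longrightarrow> line t b \<in> C i \<Longrightarrow> coord (c i) t \<noteq> v"
proof -
  define T where "T = (\<Pi>\<^sub>E j\<in>{Suc t..r}. {..<q j})"
  \<comment> \<open>\<open>h\<close> sends later coordinates \<open>s\<close> to coordinate
    \<open>t\<close> of the center of the cluster containing the corresponding line. The entry
    \<open>s t\<close> is \<open>undefined\<close>, but the line forgets it.\<close>
  define h where "h = (\<lambda>s. coord (c (SOME i. i < num \<and> line t (\<lambda>j. if j < t then a j else s j) \<in> C i)) t)"
  have fin: "finite T" by (auto simp: T_def intro: finite_PiE)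
  have "card (h ` T) \<le> card T" using fin by (rule card_image_le)
  also have "\<dots> < q t" using q_grows[OF t] by (simp add: T_def card_PiE)
  finally have "\<not> {..<q t} \<subseteq> h ` T"
    using fin by (metis card_lessThan card_mono finite_imageI leD)
  then obtain v where v: "v < q t" "v \<notin> h ` T" by blast
  have "coord (c i) t \<noteq> v"
    if i: "i < num" and b: "b \<in> box" "\<forall>j<t. b j = a j" "line t b \<in> C i" for i b
  proof -
    define s where "s = restrict b {Suc t..r}"
    have "s \<in> T" using b(1) by (auto simp: s_def T_def box_def)
    have eq: "line t (\<lambda>j. if j < t then a j else s j) = line t b"
      using b(2) by (auto simp: line_eq_iff s_def)
    \<comment> \<open>Disjointness leaves \<open>i\<close> as the only choice.\<close>
    have "(SOME i. i < num \<and> line t b \<in> C i) = i"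
      using i b(3) disj by (intro some_equality) (auto simp: disjoint_family_on_def)
    then have "h s = coord (c i) t" by (simp add: h_def eq)
    then show ?thesis using v(2) imageI[OF \<open>s \<in> T\<close>, of h] by metis
  qed
  with v(1) show ?thesis by (rule that)
qed

text \<open>Induction on \<open>t\<close>, fixing one more coordinate each time. The clause on
  coordinate 0 keeps all centers out of \<open>region t a\<close>, so a cluster that meets the
  region must leave it on the way to its center.\<close>

lemma ex_far_prefix:
  assumes sol: "(C, c) \<in> disjoint_solutions points line_graph num" and t: "t < r"
  shows "\<exists>a\<in>box. (\<forall>i<num. coord (c i) 0 \<noteq> a 0) \<and>
    (\<forall>i<num. C i \<inter> region t a \<noteq> {} \<longrightarrow> (\<forall>j\<le>t. coord (c i) j \<noteq> a j))"
  using t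
proof (induct t)
  case 0
  obtain m where m: "m < q 0" "\<And>i. i < num \<Longrightarrow> coord (c i) 0 \<noteq> m" by (rule ex_missed_copy[of c]) blast
  then have "(\<lambda>_. 0)(0 := m) \<in> box" using q_pos by (auto simp: box_def)
  then show ?case using m(2) by (intro bexI[of _ "(\<lambda>_. 0)(0 := m)"]) auto
next
  case (Suc t)
  then obtain a where a: "a \<in> box" "\<And>i. i < num \<Longrightarrow> coord (c i) 0 \<noteq> a 0"
    "\<And>i j. i < num \<Longrightarrow> C i \<inter> region t a \<noteq> {} \<Longrightarrow> j \<le> t \<Longrightarrow> coord (c i) j \<noteq> a j"
    by force
  obtain v where v: "v < q (Suc t)" "\<And>i b. i < num \<Longrightarrow> b \<in> box \<Longrightarrow> \<forall>j<Suc t. b j = a j \<Longrightarrow>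
      line (Suc t) b \<in> C i \<Longrightarrow> coord (c i) (Suc t) \<noteq> v"
    using coord_avoiding_centers[of C "Suc t" a c] sol Suc.prems
    by (auto simp: disjoint_solutions_def)
  define a' where "a' = a(Suc t := v)"
  \<comment> \<open>Fixing one more coordinate shrinks the region, so the inequalities up to
    \<open>t\<close> carry over.\<close>
  have sub: "region (Suc t) a' \<subseteq> region t a"
    unfolding region_def a'_def by fastforce
  have "coord (c i) j \<noteq> a' j"
    if i: "i < num" and meet: "C i \<inter> region (Suc t) a' \<noteq> {}" and j: "j \<le> Suc t" for i j
  proof (cases "j = Suc t")
    case True
    obtain u where u: "u \<in> C i" "u \<in> region (Suc t) a'" using meet by blast
    have "Digraph_Component.connected (with_proj line_graph \<restriction> C i)" "c i \<in> C i"
      using sol i by (auto simp: disjoint_solutions_def nondisjoint_solutions_def)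
    then have "(u, c i) \<in> rtrancl_on (C i) (links \<union> links\<inverse>)"
      using u(1) by (simp add: connected_lines_iff)
    \<comment> \<open>Lines in the region do not forget coordinate 0, and no center shares its
      value.\<close>
    moreover have "c i \<notin> region (Suc t) a'"
    proof
      assume "c i \<in> region (Suc t) a'"
      then obtain s b where "c i = line s b" "Suc t < s" "b 0 = a' 0" unfolding region_def by blast
      then show False using a(2)[OF i] by (simp add: a'_def coord_line)
    qed
    ultimately obtain x y where xy: "(x, y) \<in> links \<union> links\<inverse>" "y \<in> C i"
      "x \<in> region (Suc t) a'" "y \<notin> region (Suc t) a'"
      by (rule rtrancl_on_crossing[OF _ u(2)])
    \<comment> \<open>The cluster leaves through a line of direction \<open>Suc t\<close>;
      \<open>v\<close> was chosen to avoid the centers of all such clusters.\<close>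
    obtain b where "y = line (Suc t) b" "b \<in> box" "\<forall>j<Suc t. b j = a' j"
      using region_exit[OF xy(1,3,4)] by blast
    then show ?thesis using v(2)[OF i, of b] xy(2) True by (simp add: a'_def)
  next
    case False
    then show ?thesis using a(3)[OF i, of j] meet sub j by (auto simp: a'_def)
  qed
  moreover have "a' \<in> box" using a(1) v(1) by (auto simp: a'_def box_def)
  moreover have "coord (c i) 0 \<noteq> a' 0" if "i < num" for i using a(2)[OF that] by (simp add: a'_def)
  ultimately show ?case by blast
qed

text \<open>\<open>region (r - 1) a\<close> contains only the line of direction \<open>r\<close>
  through \<open>a\<close>, which forgets no coordinate below \<open>r\<close>. The center of its
  cluster differs from it in all of these.\<close>

lemma disjoint_radius_ge:
  assumes sol: "(C, c) \<in> disjoint_solutions points line_graph num"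
  shows "real r \<le> radius hamming num C c"
proof -
  have nsol: "(C, c) \<in> nondisjoint_solutions points line_graph num"
    using sol by (auto simp: disjoint_solutions_def)
  obtain a where a: "a \<in> box"
    "\<And>i j. i < num \<Longrightarrow> C i \<inter> region (r - 1) a \<noteq> {} \<Longrightarrow> j \<le> r - 1 \<Longrightarrow> coord (c i) j \<noteq> a j"
    using ex_far_prefix[OF sol, of "r - 1"] r_pos by force
  define x where "x = line r a"
  have "x \<in> points" using a(1) by (simp add: x_def line_points)
  then obtain i where i: "i < num" "x \<in> C i" using solution_covers[OF nsol] by blast
  have "x \<in> region (r - 1) a" using a(1) r_pos by (auto simp: x_def intro: line_region)
  then have far: "coord (c i) j \<noteq> coord x j" if "j < r" for j
    using a(2)[OF i(1), of j] i(2) that by (fastforce simp: x_def coord_line)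
  have "Suc ` {..<r} \<subseteq> {l. l < r + 2 \<and> list_decode x ! l \<noteq> list_decode (c i) ! l}"
    using far by (fastforce simp: coord_def)
  then have "card (Suc ` {..<r}) \<le> card {l. l < r + 2 \<and> list_decode x ! l \<noteq> list_decode (c i) ! l}"
    by (intro card_mono) auto
  then have "real r \<le> hamming x (c i)" by (simp add: hamming_def card_image)
  then show ?thesis using radius_ge[OF nsol i] by simp
qed

section \<open>Optimal radii and their ratio\<close>

lemma opt_nondisjoint_le: "opt_radius hamming num (nondisjoint_solutions points line_graph num) \<le> 3"
proof -
  obtain C c where Cc: "(C, c) \<in> nondisjoint_solutions points line_graph num"
    "radius hamming num C c \<le> 3" by (rule nondisjoint_solution_radius_le)
  have "bdd_below ((\<lambda>(C, c). radius hamming num C c) ` nondisjoint_solutions points line_graph num)"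
    using radius_nonneg by (auto intro!: bdd_belowI[of _ 0])
  from cINF_lower[OF this Cc(1)] show ?thesis using Cc(2) by (simp add: opt_radius_def)
qed

lemma opt_nondisjoint_ge: "1 \<le> opt_radius hamming num (nondisjoint_solutions points line_graph num)"
proof -
  have "nondisjoint_solutions points line_graph num \<noteq> {}"
    using nondisjoint_solution_radius_le by blast
  then show ?thesis
    unfolding opt_radius_def using nondisjoint_radius_ge_1 by (auto intro!: cINF_greatest)
qed

lemma opt_disjoint_ge: "real r \<le> opt_radius hamming num (disjoint_solutions points line_graph num)"
  unfolding opt_radius_def
  using disjoint_solutions_nonempty disjoint_radius_ge by (auto intro!: cINF_greatest)

lemma opt_ratio_ge:
  "real r / 3 \<le> opt_radius hamming num (disjoint_solutions points line_graph num) /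
     opt_radius hamming num (nondisjoint_solutions points line_graph num)"
  using opt_disjoint_ge opt_nondisjoint_le opt_nondisjoint_ge by (intro frac_le) auto

end

section \<open>Grid sizes and their growth\<close>

fun tail_prod :: "nat \<Rightarrow> nat" where
  "tail_prod 0 = 1"
| "tail_prod (Suc n) = tail_prod n * (tail_prod n + 1)"

text \<open>Each size is one more than the product of the later ones; from the last coordinate
  backwards this is Sylvester's sequence 2, 3, 7, 43. Splitting off the first factor gives the
  recursion of \<open>tail_prod\<close>.\<close>

lemma prod_tail_prod:
  assumes "t \<le> r"
  shows "(\<Prod>j=Suc t..r. tail_prod (r - j) + 1) = tail_prod (r - t)"
  using assms
proof (induct t rule: inc_induct)
  case (step t)
  have "{Suc t..r} = insert (Suc t) {Suc (Suc t)..r}" using step by auto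
  moreover have "r - t = Suc (r - Suc t)" using step by simp
  ultimately show ?case using step by simp
qed simp

lemma tail_prod_ge: "2 ^ n \<le> tail_prod n"
proof (induct n)
  case (Suc n)
  have "2 ^ n * 2 \<le> tail_prod n * (tail_prod n + 1)"
    using Suc order_trans[OF one_le_power Suc] by (intro mult_mono) auto
  then show ?case by simp
qed simp

text \<open>Since \<open>x * (x + 1) + 1 \<le> (x + 1)^2\<close>, the value plus 1 at most squares
  in each step.\<close>

lemma tail_prod_less: "tail_prod n + 1 \<le> 2 ^ (2 ^ n)"
proof (induct n)
  case (Suc n)
  have "tail_prod (Suc n) + 1 \<le> (tail_prod n + 1)\<^sup>2" by (simp add: power2_eq_square)
  also have "\<dots> \<le> (2 ^ (2 ^ n))\<^sup>2" using Suc by (intro power_mono) auto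
  also have "\<dots> = 2 ^ (2 ^ Suc n)" by (simp add: power_mult[symmetric] mult.commute)
  finally show ?case .
qed simp

lemma ln_ln_tail_prod:
  assumes "2 \<le> n"
  shows "0 \<le> ln (ln (real (tail_prod n)))" "ln (ln (real (tail_prod n))) \<le> real n"
proof -
  \<comment> \<open>From \<open>n \<ge> 2\<close> the value is at least 4, beyond
    \<open>exp 1\<close>; \<open>tail_prod 1 = 2\<close> would make the double logarithm
    negative.\<close>
  have "(2::nat) ^ 2 \<le> 2 ^ n" using assms by (intro power_increasing) auto
  then have "4 \<le> tail_prod n" using tail_prod_ge[of n] by simp
  then have ge: "exp 1 \<le> real (tail_prod n)" using exp_le by linarith
  then have ge1: "1 \<le> ln (real (tail_prod n))"
    using ln_ge_iff[of "real (tail_prod n)" 1] order_less_le_trans[OF exp_gt_zero ge] by blast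
  then show "0 \<le> ln (ln (real (tail_prod n)))" by simp
  have "real (tail_prod n) \<le> real (2 ^ (2 ^ n))" using tail_prod_less[of n] by linarith
  then have "ln (real (tail_prod n)) \<le> ln (real (2 ^ (2 ^ n)))"
    using \<open>4 \<le> tail_prod n\<close> by (intro ln_mono) auto
  also have "\<dots> = 2 ^ n * ln 2" by (simp add: ln_realpow)
  also have "\<dots> \<le> 2 ^ n" using ln_2_less_1 by simp
  finally have "ln (ln (real (tail_prod n))) \<le> ln (2 ^ n)" using ge1 by (intro ln_mono) auto
  also have "\<dots> = n * ln 2" by (simp add: ln_realpow)
  also have "\<dots> \<le> n" using ln_2_less_1 by (simp add: mult_left_le)
  finally show "ln (ln (real (tail_prod n))) \<le> real n" .
qed

lemma line_instance_tail_prod: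
  assumes "1 \<le> r"
  shows "line_instance r (\<lambda>j. tail_prod (r - j) + 1)"
  using assms by unfold_locales (auto simp: prod_tail_prod[of _ r, simplified])

section \<open>The family of instances\<close>

theorem theorem31:
  shows "\<exists>(V :: nat \<Rightarrow> nat set) (d :: nat \<Rightarrow> nat \<Rightarrow> nat \<Rightarrow> real)
      (G :: nat \<Rightarrow> nat pair_pre_digraph) (k :: nat \<Rightarrow> nat).
    (\<forall>n. connected_k_center (V n) (d n) (G n) (k n) \<and>
         disjoint_solutions (V n) (G n) (k n) \<noteq> {} \<and>
         opt_radius (d n) (k n) (nondisjoint_solutions (V n) (G n) (k n)) > 0) \<and>
    filterlim k at_top sequentially \<and>
    (\<lambda>n. opt_radius (d n) (k n) (disjoint_solutions (V n) (G n) (k n)) /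
         opt_radius (d n) (k n) (nondisjoint_solutions (V n) (G n) (k n)))
      \<in> \<Omega>(\<lambda>n. ln (ln (real (k n))))"
proof -
  \<comment> \<open>Instance \<open>n\<close> has \<open>r = Suc n\<close>, as
    \<open>r \<ge> 1\<close> is required. Sizes depend on the distance to the last
    coordinate.\<close>
  define q where "q = (\<lambda>n j. tail_prod (Suc n - j) + 1)"
  have inst: "line_instance (Suc n) (q n)" for n
    unfolding q_def by (rule line_instance_tail_prod) simp
  define V where "V = (\<lambda>n. line_instance.points (Suc n) (q n))"
  define d where "d = (\<lambda>n. line_instance.hamming (Suc n))"
  define G where "G = (\<lambda>n. line_instance.line_graph (Suc n) (q n))"
  define k where "k = (\<lambda>n. tail_prod (Suc n))"
  have k: "line_instance.num (Suc n) (q n) = k n" for n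
  proof -
    have "line_instance.num (Suc n) (q n) = (\<Prod>j=1..Suc n. q n j)"
      by (rule line_instance.num_def[OF inst])
    then show ?thesis using prod_tail_prod[of 0 "Suc n"] unfolding q_def k_def
      by (simp only: One_nat_def diff_zero le0)
  qed
  let ?dis = "\<lambda>n. opt_radius (d n) (k n) (disjoint_solutions (V n) (G n) (k n))"
  let ?non = "\<lambda>n. opt_radius (d n) (k n) (nondisjoint_solutions (V n) (G n) (k n))"
  have ratio: "real (Suc n) / 3 \<le> ?dis n / ?non n" for n
    using line_instance.opt_ratio_ge[OF inst, of n] by (simp add: V_def d_def G_def k)
  have "connected_k_center (V n) (d n) (G n) (k n) \<and> disjoint_solutions (V n) (G n) (k n) \<noteq> {} \<and>
      ?non n > 0" for n
    using line_instance.connected_k_center_lines[OF inst, of n]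
      line_instance.disjoint_solutions_nonempty[OF inst, of n]
      line_instance.opt_nondisjoint_ge[OF inst, of n]
    by (simp add: V_def d_def G_def k)
  moreover have "filterlim k at_top sequentially"
  proof (rule filterlim_at_top_mono)
    show "filterlim (\<lambda>n::nat. n) at_top sequentially" by (rule filterlim_ident)
    have "n \<le> k n" for n
      using less_exp[of "Suc n"] tail_prod_ge[of "Suc n"] unfolding k_def by linarith
    then show "\<forall>\<^sub>F n in sequentially. n \<le> k n" by simp
  qed
  moreover have "(\<lambda>n. ?dis n / ?non n) \<in> \<Omega>(\<lambda>n. ln (ln (real (k n))))"
  \<comment> \<open>The constant combines the ratio bound \<open>r / 3\<close> with
    \<open>ln (ln k) \<le> r\<close> for \<open>r = Suc n\<close>.\<close>
  proof (rule landau_omega.bigI[of "1 / 3"])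
    show "\<forall>\<^sub>F n in sequentially. norm (?dis n / ?non n) \<ge> 1 / 3 * norm (ln (ln (real (k n))))"
      using eventually_ge_at_top[of 1]
    proof eventually_elim
      case (elim n)
      \<comment> \<open>Here \<open>n \<ge> 1\<close> gives \<open>Suc n \<ge> 2\<close>, as the
        bounds on the double logarithm require.\<close>
      then have "0 \<le> ln (ln (real (k n)))" "ln (ln (real (k n))) \<le> real (Suc n)"
        using ln_ln_tail_prod[of "Suc n"] by (simp_all only: k_def)
      then have "1 / 3 * norm (ln (ln (real (k n)))) \<le> real (Suc n) / 3" by simp
      also have "\<dots> \<le> ?dis n / ?non n" by (rule ratio)
      also have "\<dots> \<le> norm (?dis n / ?non n)" unfolding real_norm_def by (rule abs_ge_self)
      finally show ?case .
    qed
  qed simp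
  ultimately show ?thesis by blast
qed

end
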